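(* Let $d\ge 2$, let $\mu$ be a probability measure on $\mathcal{P}$, and let $(X_n)_{n\ge 0}$ be the random walk in i.i.d. random environment determined by $\mu$, with annealed law $P$. Fix $\ell\in\mathbb{R}^d\setminus\{o\}$ and let $A_+$ and $A_-$ denote the events that $X_n\cdot\ell\to+\infty$ and $X_n\cdot\ell\to-\infty$ (as $n\to\infty$) respectively. Then $P(A_+\cup A_-)\in\{0,1\}$.
   Context: $\mathcal{E}=\{\pm e_i: i=1,\dots,d\}$ is the set of unit vectors in $\mathbb{Z}^d$ and $o$ is the origin. $\mathcal{P}$ is the set of probability measures on $\mathcal{E}$, and $\mu$ is a probability measure on $\mathcal{P}$. $\Omega=\mathcal{P}^{\mathbb{Z}^d}$ carries the product measure $\nu=\mu^{\otimes\mathbb{Z}^d}$; an environment is $\omega=(\omega_x)_{x\in\mathbb{Z}^d}\in\Omega$ (so the $\omega_x$ are i.i.d. with law $\mu$ under $\nu$), and $\omega_x(e)$ means $\omega_x(\{e\})$. Given $\omega$, $\mathbb{P}_\omega$ is the law of the time-homogeneous Markov chain $(X_n)_{n\ge0}$ on $\mathbb{Z}^d$ with $X_0=o$ and transition probability $\omega_x(e)$ from $x$ to $x+e$, $e\in\mathcal{E}$. The annealed law is $P(\cdot)=\int \mathbb{P}_\omega(\cdot)\,d\nu(\omega)$. No ellipticity is assumed: $\omega_x(e)$ may vanish. *)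

theory Defs
  imports "HOL-Probability.Probability"
begin

definition unit_steps :: "(int ^ 'd) set" where
  "unit_steps = {axis i 1 |i. True} \<union> {- axis i 1 |i. True}"

(* The probability measures on the unit steps, with the sigma-algebra generated by the
   evaluations p \<mapsto> p A. *)
definition step_laws :: "(int ^ 'd) measure measure" where
  "step_laws = prob_algebra (count_space unit_steps)"

definition environment_law ::
    "(int ^ 'd) measure measure \<Rightarrow> (int ^ 'd \<Rightarrow> (int ^ 'd) measure) measure" where
  "environment_law \<mu> = (\<Pi>\<^sub>M x\<in>UNIV. \<mu>)"

definition path_space :: "(nat \<Rightarrow> int ^ 'd) measure" where
  "path_space = (\<Pi>\<^sub>M n\<in>UNIV. count_space UNIV)"

(* The conditional law of the n-th position given the path h up to time n - 1. *)
primrec walk_kernel ::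
    "(int ^ 'd \<Rightarrow> (int ^ 'd) measure) \<Rightarrow> nat \<Rightarrow> (nat \<Rightarrow> int ^ 'd) \<Rightarrow> (int ^ 'd) measure" where
  "walk_kernel \<omega> 0 h = return (count_space UNIV) 0"
| "walk_kernel \<omega> (Suc n) h = distr (\<omega> (h n)) (count_space UNIV) (\<lambda>e. h n + e)"

(* The path measure that the Ionescu-Tulcea theorem builds from these kernels; its
   finite-dimensional distributions are computed in quenched_law_cylinder below. *)
definition quenched_law ::
    "(int ^ 'd \<Rightarrow> (int ^ 'd) measure) \<Rightarrow> (nat \<Rightarrow> int ^ 'd) measure" where
  "quenched_law \<omega> =
     projective_family.lim UNIV
       (Ionescu_Tulcea.CI (walk_kernel \<omega>) (\<lambda>_. count_space UNIV)) (\<lambda>_. count_space UNIV)"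

(* Bind is integration of the quenched laws over the environment,
   see emeasure_annealed_law below. *)
definition annealed_law :: "(int ^ 'd) measure measure \<Rightarrow> (nat \<Rightarrow> int ^ 'd) measure" where
  "annealed_law \<mu> = environment_law \<mu> \<bind> quenched_law"

definition proj :: "real ^ 'd \<Rightarrow> int ^ 'd \<Rightarrow> real" where
  "proj l x = (\<chi> i. real_of_int (x $ i)) \<bullet> l"

definition A_plus :: "real ^ 'd \<Rightarrow> (nat \<Rightarrow> int ^ 'd) set" where
  "A_plus l = {X. filterlim (\<lambda>n. proj l (X n)) at_top sequentially}"

definition A_minus :: "real ^ 'd \<Rightarrow> (nat \<Rightarrow> int ^ 'd) set" where
  "A_minus l = {X. filterlim (\<lambda>n. proj l (X n)) at_bot sequentially}"


lemma space_path_space [simp]: "space path_space = UNIV"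
  by (simp add: path_space_def space_PiM)

lemma in_space_step_laws:
  "p \<in> space step_laws \<longleftrightarrow> sets p = Pow unit_steps \<and> prob_space p"
  by (simp add: step_laws_def space_prob_algebra)

lemma Ionescu_Tulcea_walk_kernel:
  assumes "\<And>x. \<omega> x \<in> space step_laws"
  shows "Ionescu_Tulcea (walk_kernel \<omega>) (\<lambda>_. count_space UNIV)"
proof (rule Ionescu_Tulcea.intro)
  have sets: "sets (\<omega> x) = Pow unit_steps" and prob: "prob_space (\<omega> x)" for x
    using assms[of x] by (auto simp: in_space_step_laws)
  have pdistr: "prob_space (distr (\<omega> x) (count_space UNIV) (\<lambda>e. x + e))" for x
    by (rule prob_space.prob_space_distr[OF prob])
       (simp add: measurable_def sets sets_eq_imp_space_eq[of _ "count_space unit_steps"])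
  show "prob_space (walk_kernel \<omega> i h)"
    if "h \<in> space (PiM {0..<i} (\<lambda>_. count_space UNIV))" for i h
    by (cases i) (auto simp: prob_space_return pdistr)
  show "walk_kernel \<omega> i \<in> measurable (PiM {0..<i} (\<lambda>_. count_space UNIV)) (subprob_algebra (count_space UNIV))" for i
  proof (cases i)
    case 0
    have "return (count_space UNIV) 0 \<in> space (subprob_algebra (count_space (UNIV :: (int^'a) set)))"
      by (simp add: space_subprob_algebra prob_space_imp_subprob_space prob_space_return)
    then show ?thesis using 0 by (simp add: measurable_const cong: measurable_cong)
  next
    case (Suc n)
    have "(\<lambda>h. h n) \<in> measurable (PiM {0..<i} (\<lambda>_. count_space (UNIV :: (int^'a) set))) (count_space UNIV)"
      using Suc by (intro measurable_component_singleton) auto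
    moreover have "(\<lambda>x. distr (\<omega> x) (count_space UNIV) (\<lambda>e. x + e)) \<in> measurable (count_space UNIV) (subprob_algebra (count_space UNIV))"
      by (auto simp: space_subprob_algebra prob_space_imp_subprob_space pdistr)
    ultimately show ?thesis
      unfolding Suc walk_kernel.simps[abs_def] by (rule measurable_compose)
  qed
qed

lemma sets_quenched_law:
  assumes "\<And>x. \<omega> x \<in> space step_laws"
  shows "sets (quenched_law \<omega>) = sets path_space"
proof -
  interpret Ionescu_Tulcea "walk_kernel \<omega>" "\<lambda>_. count_space UNIV"
    by (rule Ionescu_Tulcea_walk_kernel) fact
  show ?thesis by (simp add: quenched_law_def path_space_def)
qed

lemma prob_space_quenched_law:
  assumes "\<And>x. \<omega> x \<in> space step_laws"
  shows "prob_space (quenched_law \<omega>)"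
proof -
  interpret Ionescu_Tulcea "walk_kernel \<omega>" "\<lambda>_. count_space UNIV"
    by (rule Ionescu_Tulcea_walk_kernel) fact
  interpret CI: prob_space "CI {}" by (rule PF.prob_space_P) auto
  have "space (CI {}) \<in> sets (PiM {} (\<lambda>_. count_space UNIV))"
    using sets.top[of "CI {}"] by (simp only: PF.sets_P finite.emptyI subset_UNIV)
  then have "emeasure PF.lim (prod_emb UNIV (\<lambda>_. count_space UNIV) {} (space (CI {}))) = 1"
    unfolding CI.emeasure_space_1[symmetric] by (intro lim) auto
  moreover have "prod_emb UNIV (\<lambda>_. count_space UNIV) {} (space (CI {})) = UNIV"
    by (auto simp: PF.space_P prod_emb_def space_PiM restrict_def)
  ultimately show ?thesis
    unfolding quenched_law_def by (intro prob_spaceI) (simp add: space_PiM)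
qed

lemma cylinder_in_path_space: "{h. \<forall>i\<le>n. h i = x i} \<in> sets path_space"
proof -
  have "{h \<in> space path_space. \<forall>i\<in>{..n}. h i \<in> {x i}} \<in> sets path_space"
    unfolding path_space_def by measurable
  then show ?thesis by (simp add: Ball_def)
qed

lemma quenched_law_cylinder:
  assumes \<omega>: "\<And>x. \<omega> x \<in> space step_laws"
  shows "emeasure (quenched_law \<omega>) {h. \<forall>i\<le>n. h i = x i} =
     (if x 0 = 0 then \<Prod>i<n. emeasure (\<omega> (x i)) ({x (Suc i) - x i} \<inter> unit_steps) else 0)"
proof -
  interpret Ionescu_Tulcea "walk_kernel \<omega>" "\<lambda>_. count_space UNIV"
    by (rule Ionescu_Tulcea_walk_kernel) fact
  let ?M = "\<lambda>_::nat. count_space (UNIV :: (int^'a) set)"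
  have [simp]: "restrict y J \<in> space (PiM J ?M)" for y J
    by (simp add: space_PiM)
  have sing: "{restrict y {0..<m}} \<in> sets (PiM {0..<m} ?M)" for y m
  proof -
    have "{restrict y {0..<m}} = (\<Pi>\<^sub>E i\<in>{0..<m}. {y i})"
      by (auto simp: PiE_iff fun_eq_iff extensional_def)
    then show ?thesis by (simp add: sets_PiM_I_finite)
  qed
  have C: "emeasure (C 0 m (\<lambda>_. undefined)) {restrict y {0..<m}} =
      (\<Prod>i<m. emeasure (walk_kernel \<omega> i (restrict y {0..<i})) {y i})" for m y
  proof (induction m)
    case 0
    have "(\<lambda>_. undefined) \<in> {restrict y {0..<0}}" by auto
    then show ?case using sing[of y 0] by (simp add: emeasure_return)
  next
    case (Suc m)
    let ?r = "restrict y {0..<m}" and ?c = "C 0 m (\<lambda>_. undefined)"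
    have sp: "space ?c = space (PiM {0..<m} ?M)" by (subst space_C) auto
    have se: "sets ?c = sets (PiM {0..<m} ?M)" by (subst sets_C) auto
    have "emeasure (C 0 (Suc m) (\<lambda>_. undefined)) {restrict y {0..<Suc m}}
        = (\<integral>\<^sup>+h. emeasure (eP m h) {restrict y {0..<Suc m}} \<partial>?c)"
      by (simp only: C.simps add_0, rule emeasure_bind[where N="PiM {0..<Suc m} ?M"])
         (use measurable_eP[of m] sing[of y "Suc m"] in
          \<open>auto simp: sp space_PiM PiE_eq_empty_iff measurable_cong_sets[OF se refl] simp del: space_PiM_empty\<close>)
    also have "\<dots> = (\<integral>\<^sup>+h. emeasure (walk_kernel \<omega> m ?r) {y m} * indicator {?r} h \<partial>?c)"
    proof (rule nn_integral_cong)
      fix h assume "h \<in> space ?c"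
      then have h: "h \<in> space (PiM {0..<m} ?M)" by (simp add: sp)
      have "(\<lambda>z. fun_upd h m z) -` {restrict y {0..<Suc m}} = (if h = ?r then {y m} else {})"
      proof (intro set_eqI iffI)
        fix z assume "z \<in> (\<lambda>z. fun_upd h m z) -` {restrict y {0..<Suc m}}"
        then have eq: "fun_upd h m z i = restrict y {0..<Suc m} i" for i by simp
        have "h i = ?r i" for i
          using eq[of i] h by (cases "i < m") (auto simp: space_PiM PiE_iff extensional_def)
        then show "z \<in> (if h = ?r then {y m} else {})"
          using eq[of m] by auto
      qed (auto simp: fun_eq_iff split: if_splits)
      then show "emeasure (eP m h) {restrict y {0..<Suc m}} = emeasure (walk_kernel \<omega> m ?r) {y m} * indicator {?r} h"
        using h sing[of y "Suc m"] by (simp add: emeasure_eP)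
    qed
    also have "\<dots> = emeasure (walk_kernel \<omega> m ?r) {y m} * emeasure ?c {?r}"
      using sing[of y m] by (subst nn_integral_cmult_indicator) (simp_all add: se)
    finally show ?case unfolding Suc by (simp add: mult.commute del: C.simps restrict_apply)
  qed
  have k: "emeasure (walk_kernel \<omega> (Suc i) (restrict x {0..<Suc i})) {x (Suc i)}
      = emeasure (\<omega> (x i)) ({x (Suc i) - x i} \<inter> unit_steps)" for i
  proof -
    have sets: "sets (\<omega> (x i)) = Pow unit_steps" using \<omega>[of "x i"] by (simp add: in_space_step_laws)
    then have sp: "space (\<omega> (x i)) = unit_steps"
      using sets_eq_imp_space_eq[of _ "count_space unit_steps"] by auto
    have "(\<lambda>e. x i + e) -` {x (Suc i)} \<inter> unit_steps = {x (Suc i) - x i} \<inter> unit_steps"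
      by (auto simp: algebra_simps)
    then show ?thesis by (simp add: emeasure_distr measurable_def sets sp)
  qed
  have "{h. \<forall>i\<le>n. h i = x i} = prod_emb UNIV ?M {0..<Suc n} {restrict x {0..<Suc n}}"
    by (auto simp: prod_emb_def space_PiM fun_eq_iff less_Suc_eq_le restrict_def) metis
  then have "emeasure (quenched_law \<omega>) {h. \<forall>i\<le>n. h i = x i} = emeasure (CI {0..<Suc n}) {restrict x {0..<Suc n}}"
    unfolding quenched_law_def using lim[of "{0..<Suc n}" "{restrict x {0..<Suc n}}"] sing[of x "Suc n"] by simp
  also have "\<dots> = emeasure (C 0 (Suc n) (\<lambda>_. undefined)) {restrict x {0..<Suc n}}"
    using emeasure_CI[of "{0..<Suc n}" "Suc n" "{restrict x {0..<Suc n}}"] sing[of x "Suc n"]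
    by (simp add: prod_emb_id space_PiM del: C.simps)
  also have "\<dots> = (\<Prod>i<Suc n. emeasure (walk_kernel \<omega> i (restrict x {0..<i})) {x i})"
    by (rule C)
  also have "\<dots> = (if x 0 = 0 then \<Prod>i<n. emeasure (\<omega> (x i)) ({x (Suc i) - x i} \<inter> unit_steps) else 0)"
    by (subst prod.lessThan_Suc_shift) (simp only: k, simp add: emeasure_return)
  finally show ?thesis .
qed

lemma sets_path_space_cylinders:
  "sets (path_space :: (nat \<Rightarrow> int ^ 'd) measure) =
     sigma_sets UNIV (insert {} {{h. \<forall>i\<le>n. h i = x i} | n x. True})" (is "_ = sigma_sets _ ?G")
proof
  have "?G \<subseteq> sets path_space" using cylinder_in_path_space by auto
  then show "sigma_sets UNIV ?G \<subseteq> sets (path_space :: (nat \<Rightarrow> int ^ 'd) measure)"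
    using sets.sigma_sets_subset[of ?G path_space] by simp
  show "sets (path_space :: (nat \<Rightarrow> int ^ 'd) measure) \<subseteq> sigma_sets UNIV ?G"
    unfolding path_space_def
  proof (rule order_trans[OF sets_PiM_in_sets[where N="sigma UNIV ?G"]])
    fix n and A :: "(int ^ 'd) set"
    have "{h \<in> space (sigma UNIV ?G). h n \<in> A} =
        (\<Union>xs\<in>{xs. length xs = Suc n \<and> xs ! n \<in> A}. {h. \<forall>i\<le>n. h i = xs ! i})" (is "?L = ?R")
    proof
      show "?L \<subseteq> ?R"
      proof
        fix h assume "h \<in> ?L"
        then show "h \<in> ?R"
          by (intro UN_I[of "map h [0..<Suc n]"]) (auto simp del: upt_Suc)
      qed
    qed auto
    also have "\<dots> \<in> sets (sigma UNIV ?G)"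
      by (intro sets.countable_UN'') auto
    finally show "{h \<in> space (sigma UNIV ?G). h n \<in> A} \<in> sets (sigma UNIV ?G)" .
  qed (auto simp: space_measure_of_conv)
qed

lemma measurable_quenched_law:
  "quenched_law \<in> measurable (\<Pi>\<^sub>M x\<in>UNIV. step_laws) (prob_algebra path_space)"
proof (rule measurable_prob_algebra_generated[OF sets_path_space_cylinders])
  let ?G = "insert {} {{h. \<forall>i\<le>n. h i = x i} | n x. True} :: (nat \<Rightarrow> int ^ 'a) set set"
  show "Int_stable ?G"
  proof (rule Int_stableI)
    have *: "{h. \<forall>i\<le>n. h i = x i} \<inter> {h. \<forall>i\<le>m. h i = y i} \<in> ?G" if "n \<le> m" for n m and x y :: "nat \<Rightarrow> int ^ 'a"
    proof (cases "\<forall>i\<le>n. x i = y i")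
      case True
      then have "{h. \<forall>i\<le>n. h i = x i} \<inter> {h. \<forall>i\<le>m. h i = y i} = {h. \<forall>i\<le>m. h i = y i}"
        using that by auto
      then show ?thesis by (metis (mono_tags, lifting) CollectI insertI2)
    next
      case False
      then have "{h. \<forall>i\<le>n. h i = x i} \<inter> {h. \<forall>i\<le>m. h i = y i} = {}"
        using that by (auto) 
      then show ?thesis by simp
    qed
    fix A B assume "A \<in> ?G" "B \<in> ?G"
    then consider "A \<inter> B = {}" | n m x y where "A = {h. \<forall>i\<le>n. h i = x i}" "B = {h. \<forall>i\<le>m. h i = y i}"
      by blast
    then show "A \<inter> B \<in> ?G"
    proof cases
      case 2
      then show ?thesis using *[of n m x y] *[of m n y x] by (metis Int_commute nat_le_linear)
    qed simp
  qed
next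
  fix A :: "(nat \<Rightarrow> int ^ 'a) set"
  assume "A \<in> insert {} {{h. \<forall>i\<le>n. h i = x i} | n x. True}"
  then consider "A = {}" | n x where "A = {h. \<forall>i\<le>n. h i = x i}" by blast
  then show "(\<lambda>\<omega>. emeasure (quenched_law \<omega>) A) \<in> borel_measurable (\<Pi>\<^sub>M x\<in>UNIV. step_laws)"
  proof cases
    case 2
    have m: "(\<lambda>\<omega>. emeasure (\<omega> y) B) \<in> borel_measurable (\<Pi>\<^sub>M x\<in>UNIV. step_laws)"
      if "B \<subseteq> unit_steps" for y :: "int ^ 'a" and B
    proof (rule measurable_compose[where g="\<lambda>p. emeasure p B" and f="\<lambda>\<omega>. \<omega> y"])
      show "(\<lambda>\<omega>. \<omega> y) \<in> measurable (\<Pi>\<^sub>M x\<in>UNIV. step_laws) step_laws"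
        by (rule measurable_component_singleton) simp
      show "(\<lambda>p. emeasure p B) \<in> borel_measurable step_laws"
        using that unfolding step_laws_def prob_algebra_def
        by (intro measurable_restrict_space1 measurable_emeasure_subprob_algebra) simp
    qed
    have "(\<lambda>\<omega>. if x 0 = 0 then \<Prod>i<n. emeasure (\<omega> (x i)) ({x (Suc i) - x i} \<inter> unit_steps) else 0)
        \<in> borel_measurable (\<Pi>\<^sub>M x\<in>UNIV. step_laws)"
      by (cases "x 0 = 0") (auto intro!: borel_measurable_prod_ennreal m)
    then show ?thesis
      unfolding 2 by (rule measurable_cong[THEN iffD1, rotated])
        (rule quenched_law_cylinder[symmetric], auto simp: space_PiM)
  qed simp
qed (auto intro!: prob_space_quenched_law sets_quenched_law simp: space_PiM)

lemma emeasure_annealed_law: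
  assumes "prob_space \<mu>" "sets \<mu> = sets step_laws" "A \<in> sets path_space"
  shows "emeasure (annealed_law \<mu>) A = (\<integral>\<^sup>+\<omega>. emeasure (quenched_law \<omega>) A \<partial>environment_law \<mu>)"
  unfolding annealed_law_def
proof (rule emeasure_bind_prob_algebra[OF _ measurable_quenched_law assms(3)])
  have "prob_space (environment_law \<mu>)"
    unfolding environment_law_def using assms(1) by (intro prob_space_PiM)
  then show "environment_law \<mu> \<in> space (prob_algebra (\<Pi>\<^sub>M x\<in>UNIV. step_laws))"
    using assms(2) by (auto simp: space_prob_algebra environment_law_def intro!: sets_PiM_cong)
qed

lemma sets_annealed_law:
  assumes "prob_space \<mu>" "sets \<mu> = sets step_laws"
  shows "sets (annealed_law \<mu>) = sets path_space" "prob_space (annealed_law \<mu>)"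
proof -
  have "prob_space (environment_law \<mu>)"
    unfolding environment_law_def using assms(1) by (intro prob_space_PiM)
  then have "environment_law \<mu> \<in> space (prob_algebra (\<Pi>\<^sub>M x\<in>UNIV. step_laws))"
    using assms(2) by (auto simp: space_prob_algebra environment_law_def intro!: sets_PiM_cong)
  from sets_bind'[OF this measurable_quenched_law] prob_space_bind'[OF this measurable_quenched_law]
  show "sets (annealed_law \<mu>) = sets path_space" "prob_space (annealed_law \<mu>)"
    by (simp_all add: annealed_law_def)
qed

lemma A_plus_A_minus_in_path_space:
  "A_plus l \<in> sets path_space" "A_minus l \<in> sets path_space"
proof -
  have [measurable]: "(\<lambda>X. proj l (X n)) \<in> borel_measurable path_space" for n
    unfolding path_space_def
    by (rule measurable_compose[OF measurable_component_singleton]) auto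
  have "A_plus l = {X \<in> space path_space. \<forall>k::nat. \<exists>N. \<forall>n\<ge>N. real k \<le> proj l (X n)}"
    unfolding A_plus_def filterlim_at_top eventually_sequentially
    by (auto, meson order_trans real_arch_simple)
  also have "\<dots> \<in> sets path_space" by measurable
  finally show "A_plus l \<in> sets path_space" .
  have "A_minus l = {X \<in> space path_space. \<forall>k::nat. \<exists>N. \<forall>n\<ge>N. proj l (X n) \<le> - real k}"
    unfolding A_minus_def filterlim_at_bot eventually_sequentially
    by (auto, metis minus_le_iff order_trans real_arch_simple)
  also have "\<dots> \<in> sets path_space" by measurable
  finally show "A_minus l \<in> sets path_space" .
qed

end

theory Submission
  imports Defs
begin

text \<open>Call a time a record if the walk is then strictly further in direction \<open>l\<close> than ever before.
  At a record the environment ahead is fresh, so each record gives the same positive chance to any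
  event of positive probability on which the walk never goes back below its starting level; hence
  infinitely many records force infinitely many such successes. If \<open>P(A_+) > 0\<close>, the walk has
  positive probability never to go below its start, and then infinitely many records imply \<open>A_+\<close>.
  If finitely many records have positive probability, then looking at the walk from its
  maximum gives a positive probability never to go above the start, and infinitely many records in
  direction \<open>- l\<close> imply \<open>A_-\<close>. Finally, finitely many records in both directions would give
  positive probability to staying above the start and bounded; this would succeed at some record
  of every path in \<open>A_+\<close>, which is absurd.\<close>

subsection \<open>Products over the sites of an i.i.d. environment\<close>

text \<open>The integrand depends only on the finitely many coordinates in \<open>J\<close>, so the
  integral is taken against the marginal on \<open>J\<close>, a finite product measure.\<close>

lemma nn_integral_PiM_prod:
  assumes "\<And>i. i \<in> I \<Longrightarrow> prob_space (M i)" and J: "finite J" "J \<subseteq> I"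
    and f: "\<And>j. j \<in> J \<Longrightarrow> f j \<in> borel_measurable (M j)"
  shows "(\<integral>\<^sup>+\<omega>. (\<Prod>j\<in>J. f j (\<omega> j)) \<partial>PiM I M) = (\<Prod>j\<in>J. \<integral>\<^sup>+p. f j p \<partial>M j)"
proof -
  \<comment> \<open>The locale \<open>product_prob_space\<close> wants a probability measure at
    every index, so \<open>M\<close> is padded outside \<open>I\<close> by a point mass.\<close>
  define M' where "M' i = (if i \<in> I then M i else return (count_space UNIV) undefined)" for i
  have M': "prob_space (M' i)" for i
    using assms(1) by (simp add: M'_def prob_space_return)
  interpret P': prob_space "M' i" for i by (rule M')
  interpret product_prob_space M' I by unfold_locales
  have PiM_eq: "PiM I M = PiM I M'" "PiM J M = PiM J M'"
    using J by (auto intro!: PiM_cong simp: M'_def)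
  have f': "f j \<in> borel_measurable (M' j)" if "j \<in> J" for j
    using f[OF that] J that by (auto simp: M'_def)
  have "(\<integral>\<^sup>+\<omega>. (\<Prod>j\<in>J. f j (\<omega> j)) \<partial>PiM I M') = (\<integral>\<^sup>+\<omega>. (\<Prod>j\<in>J. f j (restrict \<omega> J j)) \<partial>PiM I M')"
    by simp
  also have "\<dots> = (\<integral>\<^sup>+\<omega>. (\<Prod>j\<in>J. f j (\<omega> j)) \<partial>distr (PiM I M') (PiM J M') (\<lambda>\<omega>. restrict \<omega> J))"
  proof (rule nn_integral_distr[symmetric])
    show "(\<lambda>\<omega>. restrict \<omega> J) \<in> measurable (PiM I M') (PiM J M')"
      using J(2) by (rule measurable_restrict_subset)
    have "(\<lambda>\<omega>. f j (\<omega> j)) \<in> borel_measurable (PiM J M')" if "j \<in> J" for j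
      using measurable_component_singleton[OF that, of M'] f'[OF that] by (rule measurable_compose)
    then have "(\<lambda>\<omega>. \<Prod>j\<in>J. f j (\<omega> j)) \<in> borel_measurable (PiM J M')"
      by (rule borel_measurable_prod_ennreal)
    then show "(\<lambda>\<omega>. \<Prod>j\<in>J. f j (\<omega> j)) \<in> borel_measurable (distr (PiM I M') (PiM J M') (\<lambda>\<omega>. restrict \<omega> J))"
      by (simp only: measurable_distr_eq1)
  qed
  also have "\<dots> = (\<Prod>j\<in>J. \<integral>\<^sup>+p. f j p \<partial>M' j)"
    unfolding distr_PiM_restrict_finite[OF J] using J f' by (intro product_nn_integral_prod) auto
  also have "\<dots> = (\<Prod>j\<in>J. \<integral>\<^sup>+p. f j p \<partial>M j)"
    using J by (intro prod.cong) (auto simp: M'_def)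
  finally show ?thesis by (simp add: PiM_eq)
qed

section \<open>Annealed weights of families of steps\<close>

locale iid_environment =
  fixes \<mu> :: "(int ^ 'd) measure measure"
  assumes prob_space_\<mu>: "prob_space \<mu>" and sets_\<mu>: "sets \<mu> = sets step_laws"
begin

text \<open>This is the annealed probability of prescribed steps \<open>b i\<close> taken at the
  sites \<open>a i\<close>. An arbitrary index set allows a path to be cut into segments that are
  reindexed separately.\<close>

definition weight :: "'i set \<Rightarrow> ('i \<Rightarrow> int ^ 'd) \<Rightarrow> ('i \<Rightarrow> int ^ 'd) \<Rightarrow> ennreal" where
  "weight I a b = (\<integral>\<^sup>+\<omega>. (\<Prod>i\<in>I. emeasure (\<omega> (a i)) ({b i} \<inter> unit_steps)) \<partial>environment_law \<mu>)"

lemma borel_measurable_step [measurable]: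
  assumes "B \<subseteq> unit_steps"
  shows "(\<lambda>p. emeasure p B) \<in> borel_measurable \<mu>"
  unfolding measurable_cong_sets[OF sets_\<mu> refl] step_laws_def prob_algebra_def
  using assms by (intro measurable_restrict_space1 measurable_emeasure_subprob_algebra) simp

lemma step_le_1:
  assumes "\<omega> \<in> space (environment_law \<mu>)"
  shows "emeasure (\<omega> x) B \<le> 1"
proof -
  have "\<omega> x \<in> space step_laws"
    using assms by (auto simp: environment_law_def space_PiM sets_eq_imp_space_eq[OF sets_\<mu>])
  then have "prob_space (\<omega> x)" by (simp add: in_space_step_laws)
  then show ?thesis by (rule prob_space.emeasure_le_1)
qed

text \<open>The factors are grouped by site. Distinct sites are independent, whereas all visits to
  one site use the same random \<open>p\<close> and stay under one integral.\<close>

lemma weight_eq_prod: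
  assumes "finite I"
  shows "weight I a b =
    (\<Prod>v\<in>a ` I. \<integral>\<^sup>+p. (\<Prod>i\<in>{i \<in> I. a i = v}. emeasure p ({b i} \<inter> unit_steps)) \<partial>\<mu>)"
proof -
  have "weight I a b =
      (\<integral>\<^sup>+\<omega>. (\<Prod>v\<in>a ` I. \<Prod>i\<in>{i \<in> I. a i = v}. emeasure (\<omega> v) ({b i} \<inter> unit_steps)) \<partial>environment_law \<mu>)"
    unfolding weight_def using assms
    by (intro nn_integral_cong) (subst prod.image_gen[where g=a], auto intro!: prod.cong)
  also have "\<dots> = (\<Prod>v\<in>a ` I. \<integral>\<^sup>+p. (\<Prod>i\<in>{i \<in> I. a i = v}. emeasure p ({b i} \<inter> unit_steps)) \<partial>\<mu>)"
    unfolding environment_law_def using assms prob_space_\<mu>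
    by (intro nn_integral_PiM_prod[where f="\<lambda>v p. \<Prod>i\<in>{i \<in> I. a i = v}. emeasure p ({b i} \<inter> unit_steps)"])
      (auto intro!: borel_measurable_prod_ennreal borel_measurable_step)
  finally show ?thesis .
qed

lemma weight_cong:
  assumes "\<And>i. i \<in> I \<Longrightarrow> a i = a' i" "\<And>i. i \<in> I \<Longrightarrow> b i = b' i"
  shows "weight I a b = weight I a' b'"
  unfolding weight_def using assms by (intro nn_integral_cong prod.cong) auto

lemma weight_reindex:
  assumes "inj_on f I"
  shows "weight (f ` I) a b = weight I (\<lambda>i. a (f i)) (\<lambda>i. b (f i))"
  unfolding weight_def by (simp add: prod.reindex[OF assms])

text \<open>All sites carry the same law, so in \<open>weight_eq_prod\<close> a factor depends on
  its site only through the indices that visit it, and a translation merely relabels sites.\<close>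

lemma weight_translate:
  assumes "finite I"
  shows "weight I (\<lambda>i. z + a i) b = weight I a b"
proof -
  have "(\<lambda>i. z + a i) ` I = (+) z ` (a ` I)" by auto
  then show ?thesis
    using assms by (simp add: weight_eq_prod prod.reindex)
qed

text \<open>Two groups of steps that use no common site see independent parts of the
  environment.\<close>

lemma weight_Un:
  assumes "finite I" "finite J" and disj: "a ` I \<inter> a ` J = {}"
  shows "weight (I \<union> J) a b = weight I a b * weight J a b"
proof -
  let ?f = "\<lambda>I v. \<integral>\<^sup>+p. (\<Prod>i\<in>{i \<in> I. a i = v}. emeasure p ({b i} \<inter> unit_steps)) \<partial>\<mu>"
  have "{i \<in> I \<union> J. a i = v} = {i \<in> I. a i = v}" if "v \<in> a ` I" for v
    using disj that by auto
  then have "prod (?f (I \<union> J)) (a ` I) = prod (?f I) (a ` I)"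
    by (intro prod.cong) simp_all
  moreover have "{i \<in> I \<union> J. a i = v} = {i \<in> J. a i = v}" if "v \<in> a ` J" for v
    using disj that by auto
  then have "prod (?f (I \<union> J)) (a ` J) = prod (?f J) (a ` J)"
    by (intro prod.cong) simp_all
  moreover have "prod (?f (I \<union> J)) (a ` (I \<union> J)) = prod (?f (I \<union> J)) (a ` I) * prod (?f (I \<union> J)) (a ` J)"
    unfolding image_Un using assms by (intro prod.union_disjoint) auto
  ultimately show ?thesis
    using assms(1,2) by (simp only: weight_eq_prod finite_Un)
qed

lemma weight_mono:
  assumes "finite I" "J \<subseteq> I"
  shows "weight I a b \<le> weight J a b"
  unfolding weight_def
proof (rule nn_integral_mono)
  fix \<omega> assume \<omega>: "\<omega> \<in> space (environment_law \<mu>)"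
  have "(\<Prod>i\<in>I. emeasure (\<omega> (a i)) ({b i} \<inter> unit_steps)) =
      (\<Prod>i\<in>I - J. emeasure (\<omega> (a i)) ({b i} \<inter> unit_steps)) * (\<Prod>i\<in>J. emeasure (\<omega> (a i)) ({b i} \<inter> unit_steps))"
    using assms(2,1) by (rule prod.subset_diff)
  also have "\<dots> \<le> 1 * (\<Prod>i\<in>J. emeasure (\<omega> (a i)) ({b i} \<inter> unit_steps))"
    by (intro mult_right_mono prod_le_1) (auto intro: step_le_1[OF \<omega>])
  finally show "(\<Prod>i\<in>I. emeasure (\<omega> (a i)) ({b i} \<inter> unit_steps)) \<le> (\<Prod>i\<in>J. emeasure (\<omega> (a i)) ({b i} \<inter> unit_steps))"
    by simp
qed

end

subsection \<open>Finite-time events\<close>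

definition cylinder :: "nat \<Rightarrow> (nat \<Rightarrow> 'a) \<Rightarrow> (nat \<Rightarrow> 'a) set" where
  "cylinder n x = {h. \<forall>i\<le>n. h i = x i}"

text \<open>One implication is enough, since agreement up to time \<open>n\<close> is symmetric.
  Measurability is not part of the definition; it follows in \<open>sets_determined_by_time\<close>
  from the countability of the cylinders.\<close>

definition determined_by_time :: "nat \<Rightarrow> (nat \<Rightarrow> 'a) set \<Rightarrow> bool" where
  "determined_by_time n F \<longleftrightarrow> (\<forall>h h'. (\<forall>i\<le>n. h i = h' i) \<longrightarrow> h \<in> F \<longrightarrow> h' \<in> F)"

lemma determined_by_timeI:
  assumes "\<And>h h'. (\<And>i. i \<le> n \<Longrightarrow> h i = h' i) \<Longrightarrow> h \<in> F \<Longrightarrow> h' \<in> F"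
  shows "determined_by_time n F"
  unfolding determined_by_time_def
proof (intro allI impI)
  fix h h' assume "\<forall>i\<le>n. h i = h' i" "h \<in> F"
  then show "h' \<in> F" by (intro assms[of h h']) simp_all
qed

lemma determined_by_timeD:
  assumes "determined_by_time n F" "h \<in> F" "\<And>i. i \<le> n \<Longrightarrow> h i = h' i"
  shows "h' \<in> F"
  using assms(1)[unfolded determined_by_time_def, THEN spec, THEN spec, THEN mp, THEN mp, of h h'] assms(2,3)
  by simp

lemma determined_by_time_mono:
  assumes "determined_by_time n F" "n \<le> m"
  shows "determined_by_time m F"
proof (rule determined_by_timeI)
  fix h h' assume "\<And>i. i \<le> m \<Longrightarrow> h i = h' i" and h: "h \<in> F"
  then have "\<And>i. i \<le> n \<Longrightarrow> h i = h' i" using assms(2) by simp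
  then show "h' \<in> F" by (rule determined_by_timeD[OF assms(1) h])
qed

lemma determined_by_time_Compl:
  assumes "determined_by_time n F"
  shows "determined_by_time n (- F)"
proof (rule determined_by_timeI)
  fix h h' assume eq: "\<And>i. i \<le> n \<Longrightarrow> h i = h' i" and "h \<in> - F"
  then show "h' \<in> - F" using determined_by_timeD[OF assms, of h' h] by auto
qed

lemma determined_by_time_Int:
  assumes "determined_by_time n F" "determined_by_time n G"
  shows "determined_by_time n (F \<inter> G)"
proof (rule determined_by_timeI)
  fix h h' assume "\<And>i. i \<le> n \<Longrightarrow> h i = h' i" "h \<in> F \<inter> G"
  then show "h' \<in> F \<inter> G"
    using determined_by_timeD[OF assms(1), of h h'] determined_by_timeD[OF assms(2), of h h'] by simp
qed

lemma determined_by_time_UN: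
  assumes "\<And>i. i \<in> I \<Longrightarrow> determined_by_time n (F i)"
  shows "determined_by_time n (\<Union>i\<in>I. F i)"
proof (rule determined_by_timeI)
  fix h h' assume eq: "\<And>i. i \<le> n \<Longrightarrow> h i = h' i" and "h \<in> (\<Union>i\<in>I. F i)"
  then obtain i where "i \<in> I" "h \<in> F i" by auto
  with determined_by_timeD[OF assms[OF this(1)] this(2) eq] show "h' \<in> (\<Union>i\<in>I. F i)" by auto
qed

lemma determined_by_time_cylinder: "determined_by_time n (cylinder n x)"
  by (auto simp: determined_by_time_def cylinder_def)

section \<open>Finite-time events as countable disjoint unions of cylinders\<close>

lemma determined_by_time_eq_Union:
  assumes "determined_by_time n F"
  shows "F = \<Union> (cylinder n ` F)"
proof
  show "F \<subseteq> \<Union> (cylinder n ` F)" by (auto simp: cylinder_def)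
  show "\<Union> (cylinder n ` F) \<subseteq> F"
  proof
    fix h assume "h \<in> \<Union> (cylinder n ` F)"
    then obtain x where "x \<in> F" "\<And>i. i \<le> n \<Longrightarrow> x i = h i" by (auto simp: cylinder_def)
    then show "h \<in> F" by (rule determined_by_timeD[OF assms])
  qed
qed

text \<open>\<open>F\<close> may be uncountable, but a cylinder remembers only a finite list of
  values.\<close>

lemma countable_cylinders:
  fixes F :: "(nat \<Rightarrow> 'a :: countable) set"
  shows "countable (cylinder n ` F)"
proof (rule countable_subset)
  have "cylinder n x = cylinder n ((!) (map x [0..<Suc n]))" for x :: "nat \<Rightarrow> 'a"
    by (auto simp: cylinder_def simp del: upt_Suc)
  then show "cylinder n ` F \<subseteq> range (\<lambda>xs. cylinder n ((!) xs))" by blast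
qed simp

lemma disjoint_cylinders: "disjoint_family_on (\<lambda>C. C) (cylinder n ` F)"
  by (auto simp: disjoint_family_on_def cylinder_def)

lemma sets_cylinder: "cylinder n x \<in> sets path_space"
  unfolding cylinder_def by (rule cylinder_in_path_space)

lemma sets_determined_by_time:
  assumes "determined_by_time n F"
  shows "F \<in> sets path_space"
proof -
  have "\<Union> (cylinder n ` F) \<in> sets path_space"
    by (intro sets.countable_Union countable_cylinders) (auto intro: sets_cylinder)
  then show ?thesis by (simp flip: determined_by_time_eq_Union[OF assms])
qed

lemma emeasure_determined_by_time_mono:
  assumes N: "sets N1 = sets path_space" "sets N2 = sets path_space"
    and F: "determined_by_time n F"
    and le: "\<And>x. x \<in> F \<Longrightarrow> emeasure N1 (cylinder n x) \<le> emeasure N2 (cylinder n x)"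
  shows "emeasure N1 F \<le> emeasure N2 F"
proof -
  have F_eq: "F = (\<Union>C\<in>cylinder n ` F. C)"
    using determined_by_time_eq_Union[OF F] by simp
  have eq: "emeasure N F = (\<integral>\<^sup>+C. emeasure N C \<partial>count_space (cylinder n ` F))"
    if "sets N = sets path_space" for N
    by (subst F_eq, rule emeasure_UN_countable[OF _ countable_cylinders disjoint_cylinders])
      (auto simp: that sets_cylinder)
  have "emeasure N1 C \<le> emeasure N2 C" if "C \<in> cylinder n ` F" for C
    using that le by auto
  then show ?thesis
    unfolding eq[OF N(1)] eq[OF N(2)] by (intro nn_integral_mono) simp
qed

text \<open>Induction over the sigma-algebra generated by the cylinders. Two measures are treated at
  once so that a single \<open>F\<close> serves to compare them.\<close>

lemma path_space_approx:
  assumes "finite_measure N1" "finite_measure N2"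
    and N: "sets N1 = sets path_space" "sets N2 = sets path_space"
    and A: "A \<in> sets (path_space :: (nat \<Rightarrow> int ^ 'd) measure)" and "0 < (e :: real)"
  shows "\<exists>n F. determined_by_time n F \<and> measure N1 (sym_diff A F) < e \<and> measure N2 (sym_diff A F) < e"
proof -
  interpret N1: finite_measure N1 by fact
  interpret N2: finite_measure N2 by fact
  have "A \<in> sigma_sets UNIV (insert {} {{h. \<forall>i\<le>n. h i = x i} | n x. True})"
    using A by (simp add: sets_path_space_cylinders)
  then show ?thesis using \<open>0 < e\<close>
  proof (induction arbitrary: e)
    case (Basic a)
    then consider "a = {}" | n x where "a = cylinder n x" by (auto simp: cylinder_def)
    then have "\<exists>n. determined_by_time n a"
    proof cases
      case 1
      then show ?thesis by (simp add: determined_by_time_def)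
    next
      case 2
      then show ?thesis using determined_by_time_cylinder by blast
    qed
    then obtain n where "determined_by_time n a" ..
    with Basic show ?case by (intro exI[of _ n] exI[of _ a]) simp
  next
    case Empty
    then show ?case by (intro exI[of _ 0] exI[of _ "{}"]) (simp add: determined_by_time_def)
  next
    case (Compl a)
    then obtain n F where "determined_by_time n F" "measure N1 (sym_diff a F) < e" "measure N2 (sym_diff a F) < e"
      by blast
    moreover have "sym_diff (UNIV - a) (- F) = sym_diff a F" by blast
    ultimately show ?case
      using determined_by_time_Compl[of n F] by (intro exI[of _ n] exI[of _ "- F"]) (simp only: simp_thms)
  next
    case (Union a)
    have a: "a i \<in> sets path_space" for i
      using Union by (simp add: sets_path_space_cylinders)
    \<comment> \<open>The part of the union missed by the first \<open>k\<close> sets decreases to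
      the empty set, so its mass is eventually below \<open>e / 2\<close>; the other half of
      \<open>e\<close> is shared among the first \<open>k\<close> approximations.\<close>
    define B where "B k = (\<Union>i. a i) - (\<Union>i<k. a i)" for k :: nat
    have B: "B k \<in> sets path_space" for k
      using a by (auto simp: B_def)
    have "decseq B" by (auto simp: B_def decseq_def)
    moreover have "(\<Inter>k. B k) = {}" by (auto simp: B_def)
    ultimately have lim: "(\<lambda>k. measure N1 (B k)) \<longlonglongrightarrow> 0" "(\<lambda>k. measure N2 (B k)) \<longlonglongrightarrow> 0"
      using N1.finite_Lim_measure_decseq[of B] N2.finite_Lim_measure_decseq[of B] B by (auto simp: N)
    have "\<forall>\<^sub>F k in sequentially. measure N1 (B k) < e / 2 \<and> measure N2 (B k) < e / 2"
      using order_tendstoD(2)[OF lim(1), of "e/2"] order_tendstoD(2)[OF lim(2), of "e/2"] Union.prems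
      by (intro eventually_conj) auto
    then obtain k where k: "measure N1 (B k) < e / 2" "measure N2 (B k) < e / 2"
      by (auto simp: eventually_sequentially)
    define d where "d = e / (2 * (k + 1))"
    have d: "0 < d" "k * d < e / 2" using Union.prems by (auto simp: d_def field_simps)
    have "\<forall>i. \<exists>n F. determined_by_time n F \<and> measure N1 (sym_diff (a i) F) < d \<and> measure N2 (sym_diff (a i) F) < d"
      using Union.IH d by blast
    then obtain n F where F: "\<And>i. determined_by_time (n i) (F i)" "\<And>i. measure N1 (sym_diff (a i) (F i)) < d"
      "\<And>i. measure N2 (sym_diff (a i) (F i)) < d"
      by metis
    let ?G = "\<Union>i<k. F i"
    have G: "determined_by_time (Max (n ` {..<k})) ?G"
      by (intro determined_by_time_UN determined_by_time_mono[OF F(1)]) auto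
    have sub: "sym_diff (\<Union>i. a i) ?G \<subseteq> B k \<union> (\<Union>i<k. sym_diff (a i) (F i))"
      by (auto simp: B_def)
    have "measure N (sym_diff (\<Union>i. a i) ?G) < e"
      if fin: "finite_measure N" and s: "sets N = sets path_space" and Bk: "measure N (B k) < e / 2"
        and Fi: "\<And>i. measure N (sym_diff (a i) (F i)) < d" for N
    proof -
      interpret finite_measure N by fact
      have [measurable]: "a i \<in> sets N" "F i \<in> sets N" "B k \<in> sets N" for i
        using a B sets_determined_by_time[OF F(1)] by (simp_all add: s)
      have "measure N (sym_diff (\<Union>i. a i) ?G) \<le> measure N (B k \<union> (\<Union>i<k. sym_diff (a i) (F i)))"
        by (rule finite_measure_mono[OF sub]) measurable
      also have "\<dots> \<le> measure N (B k) + measure N (\<Union>i<k. sym_diff (a i) (F i))"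
        by (rule measure_Un_le) measurable
      also have "measure N (\<Union>i<k. sym_diff (a i) (F i)) \<le> (\<Sum>i<k. measure N (sym_diff (a i) (F i)))"
        by (rule finite_measure_subadditive_finite) auto
      also have "\<dots> \<le> (\<Sum>i<k. d)"
        using Fi by (intro sum_mono less_imp_le)
      finally show ?thesis using d Bk by simp
    qed
    then show ?case
      using G F k assms(1,2) N by blast
  qed
qed

text \<open>The sets \<open>D n\<close> make room for comparisons known only on some cylinders, such
  as the product formula at records, which concerns continuations that have not gone below their
  start.\<close>

lemma emeasure_mono_from_cylinders:
  fixes B :: "(nat \<Rightarrow> int ^ 'd) set"
  assumes fin: "finite_measure N1" "finite_measure N2"
    and N: "sets N1 = sets path_space" "sets N2 = sets path_space"
    and B: "B \<in> sets path_space" "\<And>n. B \<subseteq> D n" and D: "\<And>n. determined_by_time n (D n)"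
    and le: "\<And>n y. y \<in> D n \<Longrightarrow> emeasure N1 (cylinder n y) \<le> emeasure N2 (cylinder n y)"
  shows "emeasure N1 B \<le> emeasure N2 B"
proof -
  interpret N1: finite_measure N1 by fact
  interpret N2: finite_measure N2 by fact
  have "measure N1 B \<le> measure N2 B"
  proof (rule field_le_epsilon)
    fix e :: real assume "0 < e"
    then obtain n F where F: "determined_by_time n F"
      "measure N1 (sym_diff B F) < e / 2" "measure N2 (sym_diff B F) < e / 2"
      using path_space_approx[OF fin N B(1), of "e / 2"] by auto
    \<comment> \<open>Cutting \<open>F\<close> down to \<open>D n\<close> makes the cylinder
      comparison applicable, and it loses nothing of \<open>B\<close>, which lies in
      \<open>D n\<close>.\<close>
    let ?F = "F \<inter> D n"
    have det: "determined_by_time n ?F"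
      using F(1) D by (rule determined_by_time_Int)
    have [measurable]: "F \<in> sets N1" "F \<in> sets N2" "?F \<in> sets N1" "?F \<in> sets N2" "B \<in> sets N1" "B \<in> sets N2"
      using sets_determined_by_time[OF F(1)] sets_determined_by_time[OF det] B by (auto simp: N)
    have "measure N1 B \<le> measure N1 (?F \<union> sym_diff B F)"
      using B(2)[of n] by (intro N1.finite_measure_mono) auto
    also have "\<dots> \<le> measure N1 ?F + measure N1 (sym_diff B F)"
      by (rule measure_Un_le) auto
    also have "measure N1 ?F \<le> measure N2 ?F"
      using emeasure_determined_by_time_mono[OF N det] le
      by (simp add: N1.emeasure_eq_measure N2.emeasure_eq_measure)
    also have "\<dots> \<le> measure N2 (B \<union> sym_diff B F)"
      by (intro N2.finite_measure_mono) auto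
    also have "\<dots> \<le> measure N2 B + measure N2 (sym_diff B F)"
      by (rule measure_Un_le) auto
    finally show "measure N1 B \<le> measure N2 B + e" using F by simp
  qed
  then show ?thesis by (simp add: N1.emeasure_eq_measure N2.emeasure_eq_measure)
qed

subsection \<open>The walk seen from a record time\<close>

definition shift :: "nat \<Rightarrow> (nat \<Rightarrow> int ^ 'd) \<Rightarrow> nat \<Rightarrow> int ^ 'd" where
  "shift m h = (\<lambda>j. h (m + j) - h m)"

text \<open>Strictness matters: all earlier sites lie strictly below the record, hence are disjoint
  from those of a continuation that is only weakly above it. Time 0 counts as a record.\<close>

definition new_max :: "real ^ 'd \<Rightarrow> (nat \<Rightarrow> int ^ 'd) \<Rightarrow> nat \<Rightarrow> bool" where
  "new_max l h n \<longleftrightarrow> (\<forall>i<n. proj l (h i) < proj l (h n))"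

definition stays_above :: "real ^ 'd \<Rightarrow> (nat \<Rightarrow> int ^ 'd) set" where
  "stays_above l = {h. \<forall>n. 0 \<le> proj l (h n)}"

lemma proj_add: "proj l (x + y) = proj l x + proj l y"
  by (simp add: proj_def inner_vec_def algebra_simps sum.distrib)

lemma proj_diff: "proj l (x - y) = proj l x - proj l y"
  by (simp add: proj_def inner_vec_def algebra_simps sum_subtractf)

lemma proj_uminus_right: "proj l (- x) = - proj l x"
  by (simp add: proj_def inner_vec_def sum_negf)

lemma proj_uminus_left: "proj (- l) x = - proj l x"
  by (simp add: proj_def)

lemma proj_axis:
  fixes l :: "real ^ 'd"
  shows "proj l (axis i 1) = l $ i"
proof -
  have "(\<chi> j. real_of_int (axis i 1 $ j)) = (axis i 1 :: real ^ 'd)"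
    by (simp add: vec_eq_iff axis_def)
  then show ?thesis by (simp add: proj_def inner_axis inner_commute[of "axis i 1"])
qed

lemma borel_measurable_proj [measurable]: "(\<lambda>h. proj l (h n)) \<in> borel_measurable path_space"
  unfolding path_space_def by (rule measurable_compose[OF measurable_component_singleton]) auto

lemma sets_stays_above: "stays_above l \<in> sets path_space"
proof -
  have "{h \<in> space path_space. \<forall>n. 0 \<le> proj l (h n)} \<in> sets path_space" by measurable
  then show ?thesis by (simp add: stays_above_def)
qed

lemma determined_by_time_vimage_shift:
  assumes "determined_by_time n F"
  shows "determined_by_time (m + n) (shift m -` F)"
proof (rule determined_by_timeI)
  fix h h' :: "nat \<Rightarrow> int ^ 'a" assume "\<And>i. i \<le> m + n \<Longrightarrow> h i = h' i" "h \<in> shift m -` F"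
  then show "h' \<in> shift m -` F"
    using determined_by_timeD[OF assms, of "shift m h" "shift m h'"] by (simp add: shift_def)
qed

lemma measurable_shift [measurable]: "shift m \<in> measurable path_space path_space"
proof (rule measurable_sigma_sets[OF sets_path_space_cylinders])
  fix A :: "(nat \<Rightarrow> int ^ 'a) set" assume "A \<in> insert {} {{h. \<forall>i\<le>n. h i = x i} | n x. True}"
  then consider "A = {}" | n x where "A = cylinder n x" by (auto simp: cylinder_def)
  then show "shift m -` A \<inter> space path_space \<in> sets path_space"
    by cases (simp_all add: sets_determined_by_time[OF determined_by_time_vimage_shift[OF determined_by_time_cylinder]])
qed auto

lemma sets_vimage_shift: "B \<in> sets path_space \<Longrightarrow> shift m -` B \<in> sets path_space"
  using measurable_sets[OF measurable_shift, of B m] by simp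

lemma determined_by_time_new_max: "determined_by_time n {h. new_max l h n}"
proof (rule determined_by_timeI)
  fix h h' assume "\<And>i. i \<le> n \<Longrightarrow> h i = h' i" "h \<in> {h. new_max l h n}"
  then show "h' \<in> {h. new_max l h n}" unfolding new_max_def by simp
qed

definition append_path :: "nat \<Rightarrow> (nat \<Rightarrow> int ^ 'd) \<Rightarrow> (nat \<Rightarrow> int ^ 'd) \<Rightarrow> nat \<Rightarrow> int ^ 'd" where
  "append_path m x y = (\<lambda>i. if i \<le> m then x i else x m + y (i - m))"

lemma cylinder_Int_vimage_shift:
  assumes "y 0 = 0"
  shows "cylinder m x \<inter> shift m -` cylinder n y = cylinder (m + n) (append_path m x y)"
proof (intro set_eqI iffI)
  fix h assume "h \<in> cylinder m x \<inter> shift m -` cylinder n y"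
  then have x: "\<And>i. i \<le> m \<Longrightarrow> h i = x i" and y: "\<And>j. j \<le> n \<Longrightarrow> h (m + j) - h m = y j"
    by (auto simp: cylinder_def shift_def)
  have "h i = x m + y (i - m)" if "m < i" "i \<le> m + n" for i
    using y[of "i - m"] that x[of m] by (simp add: algebra_simps)
  with x show "h \<in> cylinder (m + n) (append_path m x y)"
    by (simp add: cylinder_def append_path_def)
next
  fix h assume h: "h \<in> cylinder (m + n) (append_path m x y)"
  then have x: "h i = x i" if "i \<le> m" for i
    using that by (simp add: cylinder_def append_path_def)
  have "h (m + j) - h m = y j" if "j \<le> n" for j
    using h that assms x[of m] by (cases "j = 0") (auto simp: cylinder_def append_path_def)
  with x show "h \<in> cylinder m x \<inter> shift m -` cylinder n y"
    by (simp add: cylinder_def shift_def)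
qed

lemma cylinder_Int_vimage_shift_empty:
  assumes "y 0 \<noteq> 0"
  shows "cylinder m x \<inter> shift m -` cylinder n y = {}"
  using assms by (auto simp: cylinder_def shift_def)

section \<open>Restarting the walk under the annealed law\<close>

context iid_environment
begin

abbreviation "P \<equiv> annealed_law \<mu>"

lemma sets_P: "sets P = sets path_space"
  by (rule sets_annealed_law(1)[OF prob_space_\<mu> sets_\<mu>])

lemma space_P: "space P = UNIV"
  using sets_eq_imp_space_eq[OF sets_P] by simp

sublocale P: prob_space P
  by (rule sets_annealed_law(2)[OF prob_space_\<mu> sets_\<mu>])

lemma in_sets_P: "A \<in> sets path_space \<Longrightarrow> A \<in> sets P"
  by (simp add: sets_P)

abbreviation path_weight :: "nat \<Rightarrow> (nat \<Rightarrow> int ^ 'd) \<Rightarrow> ennreal" where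
  "path_weight n x \<equiv> weight {..<n} x (\<lambda>i. x (Suc i) - x i)"

lemma emeasure_cylinder:
  "emeasure P (cylinder n x) = (if x 0 = 0 then path_weight n x else 0)"
proof -
  have "emeasure P (cylinder n x) = (\<integral>\<^sup>+\<omega>. emeasure (quenched_law \<omega>) (cylinder n x) \<partial>environment_law \<mu>)"
    by (rule emeasure_annealed_law[OF prob_space_\<mu> sets_\<mu> sets_cylinder])
  also have "\<dots> = (\<integral>\<^sup>+\<omega>. (if x 0 = 0 then \<Prod>i<n. emeasure (\<omega> (x i)) ({x (Suc i) - x i} \<inter> unit_steps) else 0) \<partial>environment_law \<mu>)"
    unfolding cylinder_def
    by (intro nn_integral_cong quenched_law_cylinder)
      (auto simp: environment_law_def space_PiM sets_eq_imp_space_eq[OF sets_\<mu>])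
  finally show ?thesis by (simp add: weight_def)
qed

text \<open>The steps are split at time \<open>m\<close>, and those after it form a translate of
  \<open>y\<close>. Dropping the early factors gives the bound; at a record the two segments share
  no site, which gives the product.\<close>

lemma path_weight_append_path:
  assumes "y 0 = 0"
  shows "path_weight (m + n) (append_path m x y) \<le> path_weight n y"
    and "new_max l x m \<Longrightarrow> (\<And>i. i \<le> n \<Longrightarrow> 0 \<le> proj l (y i)) \<Longrightarrow>
      path_weight (m + n) (append_path m x y) = path_weight m x * path_weight n y"
proof -
  let ?z = "append_path m x y"
  let ?b = "\<lambda>i. ?z (Suc i) - ?z i"
  have split: "{..<m + n} = {..<m} \<union> (+) m ` {..<n}"
  proof -
    have "i \<in> (+) m ` {..<n}" if "i < m + n" "\<not> i < m" for i
      using that by (intro image_eqI[of _ _ "i - m"]) auto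
    then show ?thesis by auto
  qed
  have z: "?z (m + j) = x m + y j" for j
    using assms by (cases "j = 0") (auto simp: append_path_def)
  have late: "weight ((+) m ` {..<n}) ?z ?b = path_weight n y"
  proof -
    have "weight ((+) m ` {..<n}) ?z ?b = weight {..<n} (\<lambda>j. x m + y j) (\<lambda>j. y (Suc j) - y j)"
      using z[of "Suc _"] by (simp add: weight_reindex z)
    also have "\<dots> = path_weight n y" by (rule weight_translate) simp
    finally show ?thesis .
  qed
  show "path_weight (m + n) ?z \<le> path_weight n y"
    unfolding late[symmetric] by (rule weight_mono) auto
  assume rec: "new_max l x m" and above: "\<And>i. i \<le> n \<Longrightarrow> 0 \<le> proj l (y i)"
  have early: "weight {..<m} ?z ?b = path_weight m x"
    by (rule weight_cong) (auto simp: append_path_def)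
  have lt: "proj l (?z i) < proj l (x m)" if "i < m" for i
    using rec that by (simp add: new_max_def append_path_def)
  have ge: "proj l (x m) \<le> proj l (?z (m + j))" if "j < n" for j
    using above[of j] that by (simp add: z proj_add)
  have "?z ` {..<m} \<inter> ?z ` (+) m ` {..<n} = {}"
  proof -
    have "?z i \<noteq> ?z (m + j)" if "i < m" "j < n" for i j
      using lt[OF that(1)] ge[OF that(2)] by auto
    then show ?thesis by auto
  qed
  then show "path_weight (m + n) ?z = path_weight m x * path_weight n y"
    unfolding split by (subst weight_Un) (simp_all add: early late)
qed

text \<open>At a general time the walk may return to used sites and there is no product formula;
  this bound still suffices to transport null events along the shift.\<close>

lemma emeasure_shift_cylinder_le:
  "emeasure P (cylinder m x \<inter> shift m -` cylinder n y) \<le> emeasure P (cylinder n y)"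
proof (cases "y 0 = 0")
  case True
  then show ?thesis
    using path_weight_append_path(1)[of y, OF True] by (simp add: cylinder_Int_vimage_shift emeasure_cylinder)
qed (simp add: cylinder_Int_vimage_shift_empty)

text \<open>At a strict record of level \<open>a\<close> only sites below level \<open>a\<close> have been used, so the environment
  at the levels from \<open>a\<close> upwards is still fresh.\<close>

lemma emeasure_shift_cylinder_record:
  assumes "new_max l x m" and "\<And>i. i \<le> n \<Longrightarrow> 0 \<le> proj l (y i)"
  shows "emeasure P (cylinder m x \<inter> shift m -` cylinder n y) =
    emeasure P (cylinder m x) * emeasure P (cylinder n y)"
proof (cases "y 0 = 0")
  case True
  then show ?thesis
    using path_weight_append_path(2)[of y l x m n, OF True assms]
    by (simp add: cylinder_Int_vimage_shift emeasure_cylinder) (simp add: append_path_def)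
qed (simp add: cylinder_Int_vimage_shift_empty emeasure_cylinder)

text \<open>Exhibits the probability of \<open>A\<close> followed by \<open>B\<close> as a measure
  in \<open>B\<close>, the form that \<open>emeasure_mono_from_cylinders\<close> takes.\<close>

lemma emeasure_distr_restricted_shift:
  assumes A: "A \<in> sets path_space" and B: "B \<in> sets path_space"
  shows "emeasure (distr (density P (indicator A)) path_space (shift m)) B = emeasure P (A \<inter> shift m -` B)"
proof -
  have "shift m \<in> measurable (density P (indicator A)) path_space"
    using measurable_shift by (simp cong: measurable_cong_sets add: sets_P)
  then show ?thesis
    using in_sets_P[OF A] in_sets_P[OF sets_vimage_shift[OF B]] B
    by (simp add: emeasure_distr emeasure_restricted space_P)
qed

lemma finite_measure_distr_restricted_shift:
  assumes A: "A \<in> sets path_space"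
  shows "finite_measure (distr (density P (indicator A)) path_space (shift m))"
proof (rule finite_measureI)
  have "UNIV \<in> sets path_space" using sets.top[of path_space] by simp
  from emeasure_distr_restricted_shift[OF A this]
  show "emeasure (distr (density P (indicator A)) path_space (shift m))
      (space (distr (density P (indicator A)) path_space (shift m))) \<noteq> \<infinity>" by simp
qed

text \<open>For each of the countably many pasts \<open>cylinder m x\<close>, the event that this
  past occurs and is followed by \<open>B\<close> is at most as likely as \<open>B\<close>, hence
  null.\<close>

lemma AE_shift_not_in:
  assumes B: "B \<in> sets path_space" and null: "AE h in P. h \<notin> B"
  shows "AE h in P. \<forall>m. shift m h \<notin> B"
proof -
  have B0: "emeasure P B = 0"
    using null B by (subst (asm) AE_iff_measurable[OF in_sets_P[OF B]]) (auto simp: space_P)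
  have "AE h in P. shift m h \<notin> B" for m
  proof -
    have cyl: "emeasure P (shift m -` B \<inter> cylinder m x) = 0" for x
    proof -
      have "emeasure P (cylinder m x \<inter> shift m -` B) \<le> emeasure P B"
        unfolding emeasure_distr_restricted_shift[OF sets_cylinder B, symmetric]
      proof (rule emeasure_mono_from_cylinders[where D="\<lambda>_. UNIV"])
        show "emeasure (distr (density P (indicator (cylinder m x))) path_space (shift m)) (cylinder n y)
            \<le> emeasure P (cylinder n y)" for n y
          unfolding emeasure_distr_restricted_shift[OF sets_cylinder sets_cylinder]
          by (rule emeasure_shift_cylinder_le)
      qed (simp_all add: B sets_P finite_measure_distr_restricted_shift sets_cylinder
          determined_by_time_def P.finite_measure_axioms)
      with B0 show ?thesis by (simp add: Int_commute)
    qed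
    \<comment> \<open>Comparison with the null measure sums the null contributions over all pasts of
      length \<open>m\<close>.\<close>
    have "emeasure (density P (indicator (shift m -` B))) UNIV \<le> emeasure (null_measure P) UNIV"
    proof (rule emeasure_determined_by_time_mono)
      show "determined_by_time m (UNIV :: (nat \<Rightarrow> int ^ 'd) set)"
        by (simp add: determined_by_time_def)
      show "emeasure (density P (indicator (shift m -` B))) (cylinder m x) \<le> emeasure (null_measure P) (cylinder m x)" for x
        by (simp add: emeasure_restricted in_sets_P sets_cylinder sets_vimage_shift[OF B] cyl)
    qed (simp_all add: sets_P)
    then have "emeasure P (shift m -` B) = 0"
      using in_sets_P[OF sets_vimage_shift[OF B, of m]] sets.top[of P]
      by (simp add: emeasure_restricted space_P)
    then show ?thesis
      by (intro AE_I[where N="shift m -` B"]) (auto simp: in_sets_P sets_vimage_shift[OF B])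
  qed
  then show ?thesis by (simp add: AE_all_countable)
qed

text \<open>Two comparisons of measures: with the past fixed, the product formula passes from
  cylinders to \<open>B\<close>; then, with \<open>B\<close> fixed, the inequality is summed over
  the pasts in \<open>H\<close>.\<close>

lemma emeasure_record_shift:
  assumes H: "determined_by_time m H" "\<And>h. h \<in> H \<Longrightarrow> new_max l h m"
    and B: "B \<in> sets path_space" "B \<subseteq> stays_above l"
  shows "emeasure P H * emeasure P B \<le> emeasure P (H \<inter> shift m -` B)"
proof -
  have cyl: "emeasure P (cylinder m x) * emeasure P B \<le> emeasure P (cylinder m x \<inter> shift m -` B)"
    if "x \<in> H" for x
  proof -
    have "emeasure (scale_measure (emeasure P (cylinder m x)) P) B
        \<le> emeasure (distr (density P (indicator (cylinder m x))) path_space (shift m)) B"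
    proof (rule emeasure_mono_from_cylinders[where D="\<lambda>n. {y. \<forall>i\<le>n. 0 \<le> proj l (y i)}"])
      show "finite_measure (scale_measure (emeasure P (cylinder m x)) P)"
        by (rule finite_measureI) (simp add: ennreal_mult_eq_top_iff)
      show "determined_by_time n {y. \<forall>i\<le>n. 0 \<le> proj l (y i)}" for n
        by (simp add: determined_by_time_def)
      show "emeasure (scale_measure (emeasure P (cylinder m x)) P) (cylinder n y)
          \<le> emeasure (distr (density P (indicator (cylinder m x))) path_space (shift m)) (cylinder n y)"
        if "y \<in> {y. \<forall>i\<le>n. 0 \<le> proj l (y i)}" for n y
        using that emeasure_shift_cylinder_record[OF H(2)[OF \<open>x \<in> H\<close>], of n y]
        by (simp add: emeasure_distr_restricted_shift sets_cylinder)
    qed (use B in \<open>auto simp: sets_P stays_above_def finite_measure_distr_restricted_shift sets_cylinder\<close>)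
    then show ?thesis by (simp add: emeasure_distr_restricted_shift sets_cylinder B)
  qed
  have "emeasure (scale_measure (emeasure P B) P) H \<le> emeasure (density P (indicator (shift m -` B))) H"
    using cyl by (intro emeasure_determined_by_time_mono[OF _ _ H(1)])
      (simp_all add: sets_P emeasure_restricted in_sets_P sets_vimage_shift[OF B(1)] sets_cylinder
        mult.commute Int_commute)
  then show ?thesis
    by (simp add: emeasure_restricted in_sets_P sets_vimage_shift[OF B(1)] sets_determined_by_time[OF H(1)]
        mult.commute Int_commute)
qed

end

subsection \<open>Records along a single path\<close>

text \<open>The first time that exceeds the maximum over the times up to \<open>k\<close> is a
  record later than \<open>k\<close>.\<close>

lemma infinitely_many_new_maxima:
  assumes "\<And>m. \<exists>n. proj l (h m) < proj l (h n)"
  shows "\<exists>\<^sub>\<infinity>m. new_max l h m"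
  unfolding INFM_nat_le
proof
  fix k
  let ?s = "\<lambda>n. proj l (h n)"
  have "Max (?s ` {..k}) \<in> ?s ` {..k}" by (intro Max_in) auto
  then obtain M where M: "Max (?s ` {..k}) = ?s M" by blast
  have le: "?s i \<le> ?s M" if "i \<le> k" for i
    unfolding M[symmetric] using that by (intro Max_ge) auto
  define n where "n = (LEAST n. ?s M < ?s n)"
  have n: "?s M < ?s n"
    unfolding n_def using assms[of M] by (rule LeastI_ex)
  have "?s i \<le> ?s M" if "i < n" for i
    using not_less_Least[of i "\<lambda>n. ?s M < ?s n"] that by (simp add: n_def)
  then have "new_max l h n" using n by (auto simp: new_max_def intro: le_less_trans)
  moreover have "k \<le> n" using le[of n] n by (cases "n \<le> k") auto
  ultimately show "\<exists>n\<ge>k. new_max l h n" by blast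
qed

lemma maximum_attained:
  assumes "\<not> (\<exists>\<^sub>\<infinity>m. new_max l h m)"
  obtains m where "\<And>n. proj l (h n) \<le> proj l (h m)"
  using infinitely_many_new_maxima[of l h] assms by (meson not_less)

lemma shift_stays_below:
  assumes "\<not> (\<exists>\<^sub>\<infinity>m. new_max l h m)"
  shows "\<exists>m. shift m h \<in> stays_above (- l)"
proof -
  obtain m where "\<And>n. proj l (h n) \<le> proj l (h m)" using assms by (rule maximum_attained) blast
  then have "shift m h \<in> stays_above (- l)"
    by (simp add: stays_above_def shift_def proj_uminus_left proj_diff)
  then show ?thesis ..
qed

lemma A_minus_eq: "A_minus l = A_plus (- l)"
  by (simp add: A_minus_def A_plus_def proj_uminus_left filterlim_uminus_at_bot)

lemma A_plus_unbounded:
  assumes "h \<in> A_plus l"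
  shows "\<exists>n. K < proj l (h n)"
proof -
  have "\<forall>\<^sub>F n in sequentially. K < proj l (h n)"
    using assms by (simp add: A_plus_def filterlim_at_top_dense)
  then show ?thesis by (auto simp: eventually_sequentially)
qed

lemma A_plus_new_maxima: "h \<in> A_plus l \<Longrightarrow> \<exists>\<^sub>\<infinity>m. new_max l h m"
  by (intro infinitely_many_new_maxima A_plus_unbounded)

lemma A_plus_new_minima:
  assumes "h \<in> A_plus l"
  shows "\<not> (\<exists>\<^sub>\<infinity>m. new_max (- l) h m)"
proof
  assume "\<exists>\<^sub>\<infinity>m. new_max (- l) h m"
  have "\<forall>\<^sub>F n in sequentially. proj l (h 0) < proj l (h n)"
    using assms by (simp add: A_plus_def filterlim_at_top_dense)
  then obtain N where N: "\<And>n. N \<le> n \<Longrightarrow> proj l (h 0) < proj l (h n)"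
    by (auto simp: eventually_sequentially)
  \<comment> \<open>\<open>Suc N\<close> makes \<open>m\<close> positive, so a record for
    \<open>- l\<close> at \<open>m\<close> lies strictly below the level at time 0.\<close>
  obtain m where "Suc N \<le> m" "new_max (- l) h m"
    using \<open>\<exists>\<^sub>\<infinity>m. new_max (- l) h m\<close> unfolding INFM_nat_le by blast
  then have "proj l (h m) < proj l (h 0)" by (auto simp: new_max_def proj_uminus_left)
  with N[of m] \<open>Suc N \<le> m\<close> show False by simp
qed

lemma proj_unit_step:
  assumes "v \<in> unit_steps"
  shows "\<exists>i. \<bar>proj l v\<bar> = \<bar>l $ i\<bar>"
  using assms by (auto simp: unit_steps_def proj_axis proj_uminus_right)

text \<open>If the levels stayed bounded they would converge; the increments take only finitely many
  values, so the levels would be eventually constant, against the strictness of the records.\<close>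

lemma A_plus_if_no_backtracking:
  fixes l :: "real ^ 'd"
  assumes good: "\<exists>\<^sub>\<infinity>m. new_max l h m \<and> shift m h \<in> stays_above l"
    and steps: "\<And>n. h (Suc n) - h n \<in> unit_steps"
  shows "h \<in> A_plus l"
proof -
  let ?s = "\<lambda>n. proj l (h n)"
  have good': "\<exists>m>k. (\<forall>i<m. ?s i < ?s m) \<and> (\<forall>n\<ge>m. ?s m \<le> ?s n)" for k
  proof -
    obtain m where m: "k < m" "new_max l h m" "shift m h \<in> stays_above l"
      using good unfolding INFM_nat by blast
    have "?s m \<le> ?s n" if "m \<le> n" for n
    proof -
      have "0 \<le> proj l (shift m h (n - m))" using m(3) by (simp add: stays_above_def)
      then show ?thesis using that by (simp add: shift_def proj_diff)
    qed
    with m show ?thesis by (auto simp: new_max_def)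
  qed
  have "\<exists>n. K < ?s n" for K
  proof (rule ccontr)
    assume "\<not> (\<exists>n. K < ?s n)"
    then have bdd: "bdd_above (range ?s)" by (auto simp: bdd_above_def not_less)
    \<comment> \<open>The smallest nonzero size of a level increment; the inserted 1 keeps the set
      nonempty. An increment smaller than \<open>d\<close> must vanish.\<close>
    define d where "d = Min (insert 1 {\<bar>l $ i\<bar> | i. l $ i \<noteq> 0})"
    have "0 < d" unfolding d_def by (subst Min_gr_iff) auto
    have d: "d \<le> \<bar>l $ i\<bar>" if "l $ i \<noteq> 0" for i
      unfolding d_def using that by (intro Min_le) auto
    have "(SUP n. ?s n) - d < (SUP n. ?s n)" using \<open>0 < d\<close> by simp
    then obtain n0 where n0: "(SUP n. ?s n) - d < ?s n0"
      using bdd by (subst (asm) less_cSUP_iff) auto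
    \<comment> \<open>From this record on, all levels lie in a window of width \<open>d\<close>
      below the supremum.\<close>
    obtain m where m: "n0 < m" "\<And>n. m \<le> n \<Longrightarrow> ?s m \<le> ?s n" "?s n0 < ?s m"
      using good'[of n0] by blast
    have bounds: "(SUP n. ?s n) - d < ?s n \<and> ?s n \<le> (SUP n. ?s n)" if "m \<le> n" for n
      using m(2)[OF that] m(3) n0 cSUP_upper[OF _ bdd, of n] by simp
    have const: "?s n = ?s m" if "m \<le> n" for n
      using that
    proof (induction n rule: dec_induct)
      case (step n)
      obtain i where i: "\<bar>?s (Suc n) - ?s n\<bar> = \<bar>l $ i\<bar>"
        using proj_unit_step[OF steps, of l n] by (auto simp: proj_diff)
      have "\<bar>?s (Suc n) - ?s n\<bar> < d"
        using bounds[of n] bounds[of "Suc n"] step.hyps by auto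
      then have "l $ i = 0" using d[of i] i by auto
      with i step.IH show ?case by simp
    qed simp
    obtain m' where "m < m'" "?s m < ?s m'" using good'[of m] by blast
    with const[of m'] show False by simp
  qed
  then have "\<exists>N. \<forall>n\<ge>N. K \<le> ?s n" for K
    using good' by (meson less_imp_le order_trans)
  then show ?thesis
    by (simp add: A_plus_def filterlim_at_top eventually_sequentially)
qed

subsection \<open>The zero-one law\<close>

lemma measurable_new_max [measurable]: "Measurable.pred path_space (\<lambda>h. new_max l h m)"
  using sets_determined_by_time[OF determined_by_time_new_max[where n=m and l=l]] by (simp add: pred_def)

context iid_environment
begin

text \<open>A path with a forbidden increment has an empty set of steps in one factor of its weight.
  There are countably many cylinders and times.\<close>

lemma AE_unit_steps: "AE h in P. \<forall>n. h (Suc n) - h n \<in> unit_steps"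
proof -
  have "AE h in P. h (Suc n) - h n \<in> unit_steps" for n
  proof -
    let ?F = "{h. h (Suc n) - h n \<notin> unit_steps} :: (nat \<Rightarrow> int ^ 'd) set"
    have F: "determined_by_time (Suc n) ?F"
      by (rule determined_by_timeI) simp
    have "emeasure P (cylinder (Suc n) x) = 0" if "x \<in> ?F" for x
    proof -
      have "(\<Prod>i<Suc n. emeasure (\<omega> (x i)) ({x (Suc i) - x i} \<inter> unit_steps)) = 0" for \<omega>
        using that by (simp add: Int_insert_left)
      then show ?thesis by (simp only: emeasure_cylinder weight_def) simp
    qed
    then have "emeasure P ?F \<le> emeasure (null_measure P) ?F"
      by (intro emeasure_determined_by_time_mono[OF _ _ F]) (simp_all add: sets_P)
    then have "emeasure P ?F = 0" by simp
    then show ?thesis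
      using in_sets_P[OF sets_determined_by_time[OF F]] by (intro AE_I[where N="?F"]) auto
  qed
  then show ?thesis by (simp add: AE_all_countable)
qed

text \<open>This replaces Levy's zero-one law. If infinitely many records without a successful restart
  had positive probability, that event would nearly coincide with one determined by some finite
  time; but at the first record after that time the restart succeeds with a fixed probability.\<close>

lemma AE_new_max_shift:
  assumes B: "B \<in> sets path_space" "B \<subseteq> stays_above l" and pos: "\<not> (AE h in P. h \<notin> B)"
  shows "AE h in P. (\<exists>\<^sub>\<infinity>m. new_max l h m) \<longrightarrow> (\<exists>\<^sub>\<infinity>m. new_max l h m \<and> shift m h \<in> B)"
proof -
  note [measurable] = B(1)
  have c: "0 < measure P B"
    using pos B(1) by (simp add: P.prob_eq_0 in_sets_P zero_less_measure_iff)
  have "AE h in P. \<not> ((\<exists>\<^sub>\<infinity>m. new_max l h m) \<and> (\<forall>m\<ge>N. new_max l h m \<longrightarrow> shift m h \<notin> B))" for N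
  proof -
    \<comment> \<open>The bad event: records continue forever, but none from time \<open>N\<close>
      on is followed by \<open>B\<close>.\<close>
    define G where "G = {h. (\<exists>\<^sub>\<infinity>m. new_max l h m) \<and> (\<forall>m\<ge>N. new_max l h m \<longrightarrow> shift m h \<notin> B)}"
    have "{h \<in> space path_space. (\<forall>k. \<exists>m\<ge>k. new_max l h m) \<and> (\<forall>m\<ge>N. new_max l h m \<longrightarrow> shift m h \<notin> B)} \<in> sets path_space"
      by measurable
    then have G: "G \<in> sets path_space" by (simp add: G_def INFM_nat_le)
    have "measure P G \<le> 0 + e" if "0 < e" for e
    proof -
      \<comment> \<open>Chosen so that the two error terms below, \<open>d / measure P B\<close> and
        \<open>d\<close>, add up to \<open>e\<close>.\<close>
      define d where "d = e / (1 / measure P B + 1)"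
      have "0 < 1 / measure P B + 1" using c by (simp add: add_pos_pos)
      then have d: "0 < d" and "d * (1 / measure P B + 1) = e" using that by (simp_all add: d_def)
      then have d_e: "d / measure P B + d = e" by (simp add: distrib_left)
      obtain n F where nF: "determined_by_time n F" "measure P (sym_diff G F) < d"
        using path_space_approx[OF P.finite_measure_axioms P.finite_measure_axioms sets_P sets_P G d] by blast
      \<comment> \<open>From time \<open>K\<close> on, \<open>F\<close> is decided and a success at
        a record rules out \<open>G\<close>.\<close>
      define K where "K = max n N"
      have F: "determined_by_time K F"
        using nF(1) by (rule determined_by_time_mono) (simp add: K_def)
      \<comment> \<open>\<open>F\<close> holds and \<open>m\<close> is the first record from
        \<open>K\<close> on. These events are disjoint and decided by time \<open>m\<close>, so the
        restart inequality applies to each.\<close>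
      define H where "H m = (if K \<le> m then F \<inter> {h. new_max l h m} \<inter> - (\<Union>j\<in>{K..<m}. {h. new_max l h j}) else {})" for m
      have H_det: "determined_by_time m (H m)" for m
      proof (cases "K \<le> m")
        case True
        have "determined_by_time m (\<Union>j\<in>{K..<m}. {h. new_max l h j})"
          by (intro determined_by_time_UN determined_by_time_mono[OF determined_by_time_new_max]) simp
        then show ?thesis
          unfolding H_def if_P[OF True]
          by (intro determined_by_time_Int determined_by_time_Compl determined_by_time_new_max
              determined_by_time_mono[OF F True])
      qed (simp add: H_def determined_by_time_def)
      have H_P: "H m \<in> sets P" "H m \<inter> shift m -` B \<in> sets P" for m
        using sets_determined_by_time[OF H_det] sets_vimage_shift[OF B(1)] by (auto simp: sets_P)
      have disj: "H i \<inter> H j = {}" if "i < j" for i j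
        using that by (auto simp: H_def)
      then have disjoint: "disjoint_family H" "disjoint_family (\<lambda>m. H m \<inter> shift m -` B)"
        unfolding disjoint_family_on_def by (metis Int_commute linorder_neqE_nat, blast dest: linorder_neqE_nat)
      let ?U = "\<Union>m. H m" and ?V = "\<Union>m. H m \<inter> shift m -` B"
      have U_P: "?U \<in> sets P" and V_P: "?V \<in> sets P"
        using H_P by auto
      have "emeasure P ?U * emeasure P B = (\<Sum>m. emeasure P (H m) * emeasure P B)"
        using H_P disjoint by (simp add: suminf_emeasure[symmetric] image_subset_iff ennreal_suminf_multc)
      also have "\<dots> \<le> (\<Sum>m. emeasure P (H m \<inter> shift m -` B))"
        by (intro suminf_le emeasure_record_shift[OF H_det _ B]) (auto simp: H_def split: if_splits)
      also have "\<dots> = emeasure P ?V"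
        using H_P disjoint by (intro suminf_emeasure) auto
      finally have "measure P ?U * measure P B \<le> measure P ?V"
        by (simp add: P.emeasure_eq_measure flip: ennreal_mult)
      also have "\<dots> \<le> measure P (sym_diff G F)"
      proof (rule P.finite_measure_mono)
        \<comment> \<open>A success at the first record from \<open>K\<close> on puts the path in
          \<open>F\<close> but outside \<open>G\<close>.\<close>
        show "?V \<subseteq> sym_diff G F"
          by (auto simp: H_def G_def K_def split: if_splits)
        show "sym_diff G F \<in> sets P"
          using G sets_determined_by_time[OF F] by (auto simp: sets_P)
      qed
      finally have U: "measure P ?U \<le> d / measure P B"
        using nF(2) c by (simp add: field_simps)
      have "G \<inter> F \<subseteq> ?U"
      proof
        fix h assume h: "h \<in> G \<inter> F"
        then have ex: "\<exists>m. K \<le> m \<and> new_max l h m" by (auto simp: G_def INFM_nat_le)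
        define m where "m = (LEAST m. K \<le> m \<and> new_max l h m)"
        have "K \<le> m \<and> new_max l h m" unfolding m_def using ex by (rule LeastI_ex)
        moreover have "\<not> new_max l h j" if "K \<le> j" "j < m" for j
          using not_less_Least[of j "\<lambda>m. K \<le> m \<and> new_max l h m"] that by (simp add: m_def)
        ultimately have "h \<in> H m" using h by (auto simp: H_def)
        then show "h \<in> ?U" by blast
      qed
      then have "measure P G \<le> measure P (?U \<union> sym_diff G F)"
        using U_P G sets_determined_by_time[OF F] by (intro P.finite_measure_mono) (auto simp: sets_P)
      also have "\<dots> \<le> measure P ?U + measure P (sym_diff G F)"
        using U_P G sets_determined_by_time[OF F] by (intro measure_Un_le) (auto simp: sets_P)
      also have "\<dots> \<le> 0 + e" using U nF(2) d_e by simp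
      finally show ?thesis .
    qed
    then have "measure P G \<le> 0" by (rule field_le_epsilon)
    then have "measure P G = 0" by (simp add: measure_le_0_iff)
    then have "AE h in P. h \<notin> G" using G by (simp add: P.prob_eq_0 in_sets_P)
    then show ?thesis by (simp add: G_def)
  qed
  then have "AE h in P. \<forall>N. \<not> ((\<exists>\<^sub>\<infinity>m. new_max l h m) \<and> (\<forall>m\<ge>N. new_max l h m \<longrightarrow> shift m h \<notin> B))"
    unfolding AE_all_countable by (rule allI)
  then show ?thesis
    by eventually_elim (auto simp: INFM_nat_le)
qed

lemma AE_A_plus_if_new_max:
  assumes "\<not> (AE h in P. h \<notin> stays_above l)"
  shows "AE h in P. (\<exists>\<^sub>\<infinity>m. new_max l h m) \<longrightarrow> h \<in> A_plus l"
  using AE_new_max_shift[OF sets_stays_above order_refl assms] AE_unit_steps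
  by eventually_elim (blast intro: A_plus_if_no_backtracking)

text \<open>A path with finitely many records attains its maximum, and seen from there it never
  rises above its start; by hypothesis this almost surely happens from no time.\<close>

lemma AE_new_max:
  assumes "AE h in P. h \<notin> stays_above (- l)"
  shows "AE h in P. \<exists>\<^sub>\<infinity>m. new_max l h m"
  using AE_shift_not_in[OF sets_stays_above assms]
  by eventually_elim (use shift_stays_below in blast)

lemma AE_A_plus_Un_A_minus:
  assumes pos: "\<not> (AE h in P. h \<notin> A_plus l)"
  shows "AE h in P. h \<in> A_plus l \<union> A_minus l"
proof -
  have "\<not> (AE h in P. h \<notin> stays_above l)"
  proof
    assume "AE h in P. h \<notin> stays_above l"
    then have "AE h in P. \<exists>\<^sub>\<infinity>m. new_max (- l) h m" by (intro AE_new_max) simp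
    then have "AE h in P. h \<notin> A_plus l"
      by eventually_elim (use A_plus_new_minima in blast)
    with pos show False by simp
  qed
  then have plus: "AE h in P. (\<exists>\<^sub>\<infinity>m. new_max l h m) \<longrightarrow> h \<in> A_plus l"
    by (rule AE_A_plus_if_new_max)
  show ?thesis
  proof (cases "AE h in P. h \<notin> stays_above (- l)")
    case True
    from AE_new_max[OF this] plus show ?thesis by eventually_elim simp
  next
    case False
    then have minus: "AE h in P. (\<exists>\<^sub>\<infinity>m. new_max (- l) h m) \<longrightarrow> h \<in> A_minus l"
      unfolding A_minus_eq by (rule AE_A_plus_if_new_max)
    \<comment> \<open>With finitely many records in both directions, the path seen from a minimum
      lies in \<open>C\<close>; so it remains to show that \<open>C\<close> is null.\<close>
    define C where "C = stays_above l \<inter> {h. \<exists>k::nat. \<forall>n. proj l (h n) \<le> k}"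
    have "{h \<in> space path_space. \<exists>k::nat. \<forall>n. proj l (h n) \<le> k} \<in> sets path_space" by measurable
    then have C: "C \<in> sets path_space" by (simp add: C_def sets_stays_above sets.Int)
    have "AE h in P. h \<notin> C"
    proof (rule ccontr)
      assume "\<not> (AE h in P. h \<notin> C)"
      then have "AE h in P. (\<exists>\<^sub>\<infinity>m. new_max l h m) \<longrightarrow> (\<exists>\<^sub>\<infinity>m. new_max l h m \<and> shift m h \<in> C)"
        using C by (intro AE_new_max_shift) (auto simp: C_def)
      then have "AE h in P. h \<notin> A_plus l"
      proof eventually_elim
        case (elim h)
        show "h \<notin> A_plus l"
        proof
          assume h: "h \<in> A_plus l"
          with elim obtain m where "shift m h \<in> C"
            using A_plus_new_maxima by (metis (mono_tags, lifting) INFM_nat_le)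
          then obtain k :: nat where "\<And>n. proj l (shift m h n) \<le> k" by (auto simp: C_def)
          then have k: "proj l (h (m + n)) \<le> k + proj l (h m)" for n
            by (simp add: shift_def proj_diff diff_le_eq)
          have "\<forall>\<^sub>F n in sequentially. k + proj l (h m) < proj l (h n)"
            using h by (simp add: A_plus_def filterlim_at_top_dense)
          then obtain N where "\<And>n. N \<le> n \<Longrightarrow> k + proj l (h m) < proj l (h n)"
            by (auto simp: eventually_sequentially)
          from this[of "m + N"] k[of N] show False by simp
        qed
      qed
      with pos show False ..
    qed
    then have "AE h in P. \<forall>m. shift m h \<notin> C" by (rule AE_shift_not_in[OF C])
    with plus minus show ?thesis
    proof eventually_elim
      case (elim h)
      show ?case
      proof (rule ccontr)
        assume "h \<notin> A_plus l \<union> A_minus l"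
        with elim have no_max: "\<not> (\<exists>\<^sub>\<infinity>m. new_max l h m)" and "\<not> (\<exists>\<^sub>\<infinity>m. new_max (- l) h m)" by auto
        \<comment> \<open>Applied to \<open>- l\<close>, the lemma about maxima yields a time of
          minimal level.\<close>
        then obtain m where m: "shift m h \<in> stays_above l"
          using shift_stays_below[of "- l" h] by auto
        obtain M where M: "\<And>n. proj l (h n) \<le> proj l (h M)"
          using no_max by (rule maximum_attained) blast
        obtain k :: nat where "proj l (h M) - proj l (h m) \<le> k" using real_arch_simple by blast
        then have "proj l (shift m h n) \<le> k" for n
          using M[of "m + n"] by (simp add: shift_def proj_diff)
        with m have "shift m h \<in> C" by (auto simp: C_def)
        with elim show False by blast
      qed
    qed
  qed
qed

end

theorem theorem1p3:
  fixes \<mu> :: "(int ^ 'd) measure measure" and l :: "real ^ 'd"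
  assumes "CARD('d) \<ge> 2"
    and "prob_space \<mu>" and "sets \<mu> = sets step_laws"
    and "l \<noteq> 0"
  shows "measure (annealed_law \<mu>) (A_plus l \<union> A_minus l) \<in> {0, 1}"
proof -
  interpret iid_environment \<mu>
    using assms(2,3) by (rule iid_environment.intro)
  have events: "A_plus l \<union> A_minus l \<in> sets P"
    using A_plus_A_minus_in_path_space[of l] by (simp add: sets_P sets.Un)
  \<comment> \<open>Replacing \<open>l\<close> by \<open>- l\<close> exchanges the two events, so
    one lemma handles both cases of positive probability; otherwise the union is null.\<close>
  consider "\<not> (AE h in P. h \<notin> A_plus l)" | "\<not> (AE h in P. h \<notin> A_plus (- l))"
    | "AE h in P. h \<notin> A_plus l" "AE h in P. h \<notin> A_minus l"
    by (auto simp: A_minus_eq)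
  then show ?thesis
  proof cases
    case 1
    from AE_A_plus_Un_A_minus[OF this] show ?thesis
      using P.prob_eq_1[OF events] by simp
  next
    case 2
    from AE_A_plus_Un_A_minus[OF this] show ?thesis
      using P.prob_eq_1[OF events] by (simp add: A_minus_eq Un_commute)
  next
    case 3
    then have "AE h in P. h \<notin> A_plus l \<union> A_minus l" by eventually_elim simp
    then show ?thesis using P.prob_eq_0[OF events] by simp
  qed
qed

end
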